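(* Consider a distributed computing network with $K$ nodes, $N$ files, $Q$ functions and intermediate values of $T$ bits, with a given file placement $\mathcal M_k$, $k\in[K]$, and function assignment $\mathcal W_k$, $k\in[K]$. Let $L^*$ be the optimal (infimal) communication load over all achievable shuffle schemes, i.e. those after which every node $k\in[K]$ has access to all intermediate values necessary to compute the functions of $\mathcal W_k$. Then for every permutation $(k_1,\dots,k_K)$ of $[K]$, $$L^*\ \ge\ \frac1{TQN}\sum_{i=1}^{K}H\left(V_{\mathcal W_{k_i},:}\,\middle|\,V_{:,\mathcal M_{k_i}},\,Y_{\{k_1,\dots,k_{i-1}\}}\right).$$
   Context: Model. Nodes are $[K]=\{1,\dots,K\}$, files $w_1,\dots,w_N$, functions $[Q]$. For $i\in[Q]$, $j\in[N]$ there is an intermediate value (IV) $v_{i,j}$, a random variable with values in $\{0,1\}^T$, computable from file $w_j$; function $i$ is computed from $v_{i,1},\dots,v_{i,N}$. Node $k$ has files $\mathcal M_k\subseteq\{w_1,\dots,w_N\}$ and computes all IVs $v_{i,j}$ with $i\in[Q]$, $w_j\in\mathcal M_k$. It is assigned functions $\mathcal W_k\subseteq[Q]$. Every file is available to at least one node, and the sets $\mathcal W_1,\dots,\mathcal W_K$ partition $[Q]$ (each function is assigned to exactly one node). Shuffle scheme: each node $k$ broadcasts to all nodes a bit string $X_k$ of some fixed length $\ell_k$ that is a function of the IVs computed by node $k$. With $X_{[K]}=(X_1,\dots,X_K)$, the scheme is achievable if $H(V_{\mathcal W_k,:}\mid X_{[K]},V_{:,\mathcal M_k})=0$ for all $k\in[K]$.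 Its communication load is $\frac{1}{QNT}\sum_k\ell_k$. Notation. $H$ is Shannon entropy in bits. For a set of functions $\mathcal W$, $V_{\mathcal W,:}=\{v_{i,j}:i\in\mathcal W,\ j\in[N]\}$; for a set of files $\mathcal M$, $V_{:,\mathcal M}=\{v_{i,j}:i\in[Q],\ w_j\in\mathcal M\}$. For $\mathcal S\subseteq[K]$, $Y_{\mathcal S}=\left(V_{\mathcal W_{\mathcal S},:},V_{:,\mathcal M_{\mathcal S}}\right)$ with $\mathcal W_{\mathcal S}=\bigcup_{k\in\mathcal S}\mathcal W_k$ and $\mathcal M_{\mathcal S}=\bigcup_{k\in\mathcal S}\mathcal M_k$ ($Y_\emptyset$ is trivial). *)

theory Defs
  imports "HOL-Probability.Probability"
begin

text \<open>
  Nodes, files and functions are numbered \<open>{1..K}\<close>, \<open>{1..N}\<close> and \<open>{1..Q}\<close>.  All random variables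
  live on one probability space \<open>P\<close>; \<open>v i j\<close> is the intermediate value of function \<open>i\<close> on
  file \<open>j\<close>.  \<open>M k\<close> is the set of (numbers of) files stored at node \<open>k\<close> and \<open>W k\<close> the set of
  functions assigned to it.
\<close>

definition bit_strings :: "nat \<Rightarrow> bool list set" where
  "bit_strings n = {bs. length bs = n}"

text \<open>
  Conditional entropy in bits of random variables with finitely many values.  This is the library's
  \<open>\<H>(X | Y)\<close> of the locale \<^locale>\<open>information_space\<close> for base 2, written so that it can be used
  outside that locale.
\<close>
definition cond_entropy :: "'a measure \<Rightarrow> ('a \<Rightarrow> 'b) \<Rightarrow> ('a \<Rightarrow> 'c) \<Rightarrow> real" where
  "cond_entropy P X Y =
     prob_space.conditional_entropy P 2 (count_space (X ` space P)) (count_space (Y ` space P)) X Y"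

text \<open>
  The tuple \<open>(v i j)\<close> for \<open>i \<in> I\<close>, \<open>j \<in> J\<close> as one random variable; its values are functions that
  are \<open>undefined\<close> outside \<open>I \<times> J\<close>.
\<close>
definition iv_tuple ::
  "(nat \<Rightarrow> nat \<Rightarrow> 'a \<Rightarrow> bool list) \<Rightarrow> nat set \<Rightarrow> nat set \<Rightarrow> 'a \<Rightarrow> nat \<times> nat \<Rightarrow> bool list" where
  "iv_tuple v I J \<omega> = (\<lambda>(i, j)\<in>I \<times> J. v i j \<omega>)"

definition V_funs ::
  "nat \<Rightarrow> (nat \<Rightarrow> nat \<Rightarrow> 'a \<Rightarrow> bool list) \<Rightarrow> nat set \<Rightarrow> 'a \<Rightarrow> nat \<times> nat \<Rightarrow> bool list" where
  "V_funs N v I = iv_tuple v I {1..N}"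

definition V_files ::
  "nat \<Rightarrow> (nat \<Rightarrow> nat \<Rightarrow> 'a \<Rightarrow> bool list) \<Rightarrow> nat set \<Rightarrow> 'a \<Rightarrow> nat \<times> nat \<Rightarrow> bool list" where
  "V_files Q v J = iv_tuple v {1..Q} J"

definition Y_nodes ::
  "nat \<Rightarrow> nat \<Rightarrow> (nat \<Rightarrow> nat \<Rightarrow> 'a \<Rightarrow> bool list) \<Rightarrow> (nat \<Rightarrow> nat set) \<Rightarrow> (nat \<Rightarrow> nat set) \<Rightarrow>
   nat set \<Rightarrow> 'a \<Rightarrow> (nat \<times> nat \<Rightarrow> bool list) \<times> (nat \<times> nat \<Rightarrow> bool list)" where
  "Y_nodes N Q v M W S \<omega> = (V_funs N v (\<Union>k\<in>S. W k) \<omega>, V_files Q v (\<Union>k\<in>S. M k) \<omega>)"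

text \<open>
  A shuffle scheme consists of message lengths \<open>len k\<close> and encoders \<open>enc k\<close>; the encoder of node
  \<open>k\<close> maps the values of all intermediate values that node \<open>k\<close> computes to \<open>len k\<close> bits.
\<close>
definition shuffle_scheme ::
  "nat \<Rightarrow> nat \<Rightarrow> nat \<Rightarrow> (nat \<Rightarrow> nat set) \<Rightarrow>
   (nat \<Rightarrow> nat) \<Rightarrow> (nat \<Rightarrow> (nat \<times> nat \<Rightarrow> bool list) \<Rightarrow> bool list) \<Rightarrow> bool" where
  "shuffle_scheme K Q T M len enc \<longleftrightarrow>
     (\<forall>k\<in>{1..K}. enc k \<in> (({1..Q} \<times> M k) \<rightarrow>\<^sub>E bit_strings T) \<rightarrow> bit_strings (len k))"

text \<open>The tuple of all broadcast messages \<open>(X\<^sub>1, \<dots>, X\<^sub>K)\<close>.\<close>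
definition messages ::
  "nat \<Rightarrow> nat \<Rightarrow> (nat \<Rightarrow> nat \<Rightarrow> 'a \<Rightarrow> bool list) \<Rightarrow> (nat \<Rightarrow> nat set) \<Rightarrow>
   (nat \<Rightarrow> (nat \<times> nat \<Rightarrow> bool list) \<Rightarrow> bool list) \<Rightarrow> 'a \<Rightarrow> nat \<Rightarrow> bool list" where
  "messages K Q v M enc \<omega> = (\<lambda>k\<in>{1..K}. enc k (V_files Q v (M k) \<omega>))"

definition achievable ::
  "'a measure \<Rightarrow> nat \<Rightarrow> nat \<Rightarrow> nat \<Rightarrow> (nat \<Rightarrow> nat \<Rightarrow> 'a \<Rightarrow> bool list) \<Rightarrow>
   (nat \<Rightarrow> nat set) \<Rightarrow> (nat \<Rightarrow> nat set) \<Rightarrow> (nat \<Rightarrow> (nat \<times> nat \<Rightarrow> bool list) \<Rightarrow> bool list) \<Rightarrow> bool" where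
  "achievable P K N Q v M W enc \<longleftrightarrow>
     (\<forall>k\<in>{1..K}. cond_entropy P (V_funs N v (W k))
                   (\<lambda>\<omega>. (messages K Q v M enc \<omega>, V_files Q v (M k) \<omega>)) = 0)"

definition comm_load :: "nat \<Rightarrow> nat \<Rightarrow> nat \<Rightarrow> nat \<Rightarrow> (nat \<Rightarrow> nat) \<Rightarrow> real" where
  "comm_load K N Q T len = (1 / (real Q * real N * real T)) * (\<Sum>k\<in>{1..K}. real (len k))"

text \<open>
  The infimum is taken in the reals.  The set is bounded below by 0, and it is nonempty whenever
  every file is stored at some node, since each node may broadcast everything it computes.
\<close>
definition optimal_load ::
  "'a measure \<Rightarrow> nat \<Rightarrow> nat \<Rightarrow> nat \<Rightarrow> nat \<Rightarrow> (nat \<Rightarrow> nat \<Rightarrow> 'a \<Rightarrow> bool list) \<Rightarrow>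
   (nat \<Rightarrow> nat set) \<Rightarrow> (nat \<Rightarrow> nat set) \<Rightarrow> real" where
  "optimal_load P K N Q T v M W =
     Inf {comm_load K N Q T len | len enc. shuffle_scheme K Q T M len enc \<and> achievable P K N Q v M W enc}"

end

theory Submission
  imports Defs
begin

text \<open>
  Let \<open>G\<close> be the tuple of all messages.  Revealing \<open>V\<^bsub>:,M\<^esub>\<close> of node \<open>\<kappa> i\<close> on top of \<open>Y\<close> of the
  earlier nodes lets \<open>G\<close> determine the outputs of node \<open>\<kappa> i\<close>, so the remaining uncertainty about \<open>G\<close>
  drops by at least the \<open>i\<close>-th summand of the bound.  Telescoping bounds the sum by \<open>H(G)\<close>, which
  is at most the total message length.
\<close>

subsection \<open>Entropy of simple functions\<close>

context information_space
begin

text \<open>Values outside the range of \<open>X\<close> have probability 0 and contribute nothing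
  to the sum. The freedom in the alphabet matters for pairs, whose range may be a proper subset of
  the product of the two ranges.\<close>

lemma entropy_superset:
  assumes X: "simple_function M X" and A: "X ` space M \<subseteq> A" "finite A"
  shows "entropy b (count_space A) X = \<H>(X)"
proof -
  let ?p = "\<lambda>x. measure M (X -` {x} \<inter> space M)"
  have eq: "entropy b (count_space B) X = - (\<Sum>x\<in>X`space M. ?p x * log b (?p x))"
    if B: "X ` space M \<subseteq> B" "finite B" for B
  proof -
    have "entropy b (count_space B) X =
        - (\<integral>x. (if x \<in> X`space M then ?p x else 0) * log b (if x \<in> X`space M then ?p x else 0) \<partial>count_space B)"
      by (rule entropy_distr[OF distributed_simple_function_superset[OF X refl B]]) simp
    also have "\<dots> = - (\<Sum>x\<in>B. (if x \<in> X`space M then ?p x else 0) * log b (if x \<in> X`space M then ?p x else 0))"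
      using B by (simp add: lebesgue_integral_count_space_finite)
    also have "\<dots> = - (\<Sum>x\<in>X`space M. ?p x * log b (?p x))"
      using B by (intro arg_cong[where f=uminus] sum.mono_neutral_cong_right) auto
    finally show ?thesis .
  qed
  show ?thesis
    using eq[OF A] eq[of "X ` space M"] simple_functionD(1)[OF X] by simp
qed

text \<open>The identity I(X;Y) = H(X) + H(Y) - H(X,Y), with room for alphabets larger than the
  ranges: the next lemma uses it with a full product as alphabet of a pair.\<close>

lemma mutual_information_superset:
  assumes X: "simple_function M X" and Y: "simple_function M Y"
    and A: "X ` space M \<subseteq> A" "finite A" and B: "Y ` space M \<subseteq> B" "finite B"
  shows "mutual_information b (count_space A) (count_space B) X Y = \<H>(X) + \<H>(Y) - \<H>(\<lambda>x. (X x, Y x))"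
proof -
  note XY = simple_function_Pair[OF X Y]
  have AB: "(\<lambda>x. (X x, Y x)) ` space M \<subseteq> A \<times> B" "finite (A \<times> B)"
    using A B by auto
  have prod: "count_space A \<Otimes>\<^sub>M count_space B = count_space (A \<times> B)"
    using A B by (simp add: pair_measure_count_space)
  note dX = distributed_simple_function_superset[OF X refl A]
  note dY = distributed_simple_function_superset[OF Y refl B]
  note dXY = distributed_simple_function_superset[OF XY refl AB, folded prod]
  have "mutual_information b (count_space A) (count_space B) X Y =
      entropy b (count_space A) X + entropy b (count_space B) Y
      - entropy b (count_space A \<Otimes>\<^sub>M count_space B) (\<lambda>x. (X x, Y x))"
    by (rule mutual_information_eq_entropy_conditional_entropy_distr[OF _ _ dX _ dY _ dXY])
       (use A(2) B(2) in \<open>auto simp: prod integrable_count_space sigma_finite_measure_count_space_finite\<close>)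
  then show ?thesis
    by (simp add: prod entropy_superset[OF X A] entropy_superset[OF Y B] entropy_superset[OF XY AB])
qed

text \<open>This is nonnegativity of I(X;Y|Z), which is by definition I(X;(Y,Z)) - I(X;Z); expanding
  both terms into entropies makes H(X) cancel.\<close>

lemma entropy_submodular:
  assumes X: "simple_function M X" and Y: "simple_function M Y" and Z: "simple_function M Z"
  shows "\<H>(\<lambda>x. (X x, Y x, Z x)) + \<H>(Z) \<le> \<H>(\<lambda>x. (X x, Z x)) + \<H>(\<lambda>x. (Y x, Z x))"
proof -
  note fin = simple_functionD(1)[OF X] simple_functionD(1)[OF Y] simple_functionD(1)[OF Z]
  have "\<I>(X ; Y | Z) =
      mutual_information b (count_space (X ` space M)) (count_space (Y ` space M \<times> Z ` space M))
        X (\<lambda>x. (Y x, Z x)) - \<I>(X ; Z)"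
    using fin by (simp add: conditional_mutual_information_def pair_measure_count_space)
  also have "\<dots> = (\<H>(X) + \<H>(\<lambda>x. (Y x, Z x)) - \<H>(\<lambda>x. (X x, Y x, Z x)))
      - (\<H>(X) + \<H>(Z) - \<H>(\<lambda>x. (X x, Z x)))"
    using fin X Y Z
    by (intro arg_cong2[where f="(-)"] mutual_information_superset) auto
  finally show ?thesis
    using conditional_mutual_information_nonneg[OF X Y Z] by simp
qed

lemma entropy_cong:
  assumes "\<And>x. x \<in> space M \<Longrightarrow> X x = Y x"
  shows "\<H>(X) = \<H>(Y)"
proof -
  have "X ` space M = Y ` space M"
    using assms by auto
  moreover have "distr M (count_space (Y ` space M)) X = distr M (count_space (Y ` space M)) Y"
    using assms by (rule distr_cong[OF refl refl])
  ultimately show ?thesis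
    by (simp add: entropy_def)
qed

text \<open>On the sample space \<open>Y\<close> factors through \<open>X\<close>, so data
  processing applies. Phrasing the dependence by fibres also lets the lemma reorder or regroup the
  components of a tuple.\<close>

lemma entropy_mono_determined:
  assumes X: "simple_function M X"
    and det: "\<And>x y. x \<in> space M \<Longrightarrow> y \<in> space M \<Longrightarrow> X x = X y \<Longrightarrow> Y x = Y y"
  shows "\<H>(Y) \<le> \<H>(X)"
proof -
  \<comment> \<open>An arbitrary outcome in the fibre of \<open>X\<close> over \<open>a\<close> is
    chosen; by \<open>det\<close> the value of \<open>Y\<close> there does not depend on the
    choice.\<close>
  define f where "f a = Y (SOME y. y \<in> space M \<and> X y = a)" for a
  have "Y x = (f \<circ> X) x" if x: "x \<in> space M" for x
  proof -
    have "(SOME y. y \<in> space M \<and> X y = X x) \<in> space M \<and> X (SOME y. y \<in> space M \<and> X y = X x) = X x"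
      using x by (intro someI[where P="\<lambda>y. y \<in> space M \<and> X y = X x"]) auto
    then show ?thesis
      using det x unfolding f_def comp_def by metis
  qed
  then have "\<H>(Y) = \<H>(f \<circ> X)"
    by (rule entropy_cong)
  then show ?thesis
    using entropy_data_processing[OF X] by simp
qed

lemma conditional_entropy_eq_diff:
  assumes X: "simple_function M X" and Y: "simple_function M Y"
  shows "\<H>(X | Y) = \<H>(\<lambda>x. (Y x, X x)) - \<H>(Y)"
  using entropy_chain_rule[OF Y X] by simp

lemma conditional_entropy_eq_0_determined:
  assumes X: "simple_function M X" and Y: "simple_function M Y"
    and det: "\<And>x y. x \<in> space M \<Longrightarrow> y \<in> space M \<Longrightarrow> Y x = Y y \<Longrightarrow> X x = X y"
  shows "\<H>(X | Y) = 0"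
proof -
  have "\<H>(\<lambda>x. (Y x, X x)) \<le> \<H>(Y)"
    using det by (intro entropy_mono_determined[OF Y]) metis
  then show ?thesis
    using conditional_entropy_eq_diff[OF X Y] conditional_entropy_nonneg[OF X Y] by simp
qed

text \<open>Conditioning on more cannot increase entropy: submodularity rewritten by the chain rule.
  The two auxiliary inequalities only reorder components.\<close>

lemma conditional_entropy_Pair_le:
  assumes X: "simple_function M X" and Y: "simple_function M Y" and Z: "simple_function M Z"
  shows "\<H>(X | (\<lambda>x. (Y x, Z x))) \<le> \<H>(X | Z)"
proof -
  have "\<H>(\<lambda>x. ((Y x, Z x), X x)) \<le> \<H>(\<lambda>x. (X x, Y x, Z x))"
    by (rule entropy_mono_determined) (use X Y Z in auto)
  moreover have "\<H>(\<lambda>x. (X x, Z x)) \<le> \<H>(\<lambda>x. (Z x, X x))"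
    by (rule entropy_mono_determined) (use X Z in auto)
  ultimately show ?thesis
    using entropy_submodular[OF X Y Z] conditional_entropy_eq_diff[OF X Z]
      conditional_entropy_eq_diff[OF X simple_function_Pair[OF Y Z]] by simp
qed

text \<open>\<open>equiv\<close> says that \<open>Y'\<close> carries the same information as
  (U,F,Y). Since (G,F) determines \<open>U\<close> almost surely, H(G|F,Y) = H(G,U|F,Y) = H(U|F,Y) +
  H(G|Y'), and H(G|F,Y) is at most H(G|Y).\<close>

lemma conditional_entropy_step:
  assumes G: "simple_function M G" and U: "simple_function M U"
    and F: "simple_function M F" and Y: "simple_function M Y" and Y': "simple_function M Y'"
    and decode: "\<H>(U | (\<lambda>x. (G x, F x))) = 0"
    and equiv: "\<And>x y. x \<in> space M \<Longrightarrow> y \<in> space M \<Longrightarrow>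
      Y' x = Y' y \<longleftrightarrow> U x = U y \<and> F x = F y \<and> Y x = Y y"
  shows "\<H>(U | (\<lambda>x. (F x, Y x))) + \<H>(G | Y') \<le> \<H>(G | Y)"
proof -
  note sf = G U F Y Y'
  \<comment> \<open>Decodability survives adding \<open>Y\<close> to the condition, so appending
    \<open>U\<close> to (Y,G,F) costs no entropy.\<close>
  have "\<H>(U | (\<lambda>x. (Y x, G x, F x))) \<le> 0"
    using conditional_entropy_Pair_le[OF U Y simple_function_Pair[OF G F]] decode by simp
  then have "\<H>(\<lambda>x. ((Y x, G x, F x), U x)) \<le> \<H>(\<lambda>x. (Y x, G x, F x))"
    using conditional_entropy_eq_diff[OF U, of "\<lambda>x. (Y x, G x, F x)"] sf by simp
  also have "\<dots> \<le> \<H>(\<lambda>x. ((F x, Y x), G x))"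
    by (rule entropy_mono_determined) (use sf in auto)
  finally have "\<H>(\<lambda>x. ((Y x, G x, F x), U x)) \<le> \<H>(\<lambda>x. ((F x, Y x), G x))" .
  \<comment> \<open>The two directions of \<open>equiv\<close> enter separately: here (U,F,Y)
    determines \<open>Y'\<close>, and in the next inequality \<open>Y'\<close> determines
    (F,Y,U).\<close>
  moreover have "\<H>(\<lambda>x. (Y' x, G x)) \<le> \<H>(\<lambda>x. ((Y x, G x, F x), U x))"
    by (rule entropy_mono_determined) (use sf equiv in auto)
  moreover have "\<H>(\<lambda>x. ((F x, Y x), U x)) \<le> \<H>(Y')"
    by (rule entropy_mono_determined) (use sf equiv in auto)
  moreover have "\<H>(G | (\<lambda>x. (F x, Y x))) \<le> \<H>(G | Y)"
    using conditional_entropy_Pair_le[OF G F Y] .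
  ultimately show ?thesis
    using conditional_entropy_eq_diff[OF G Y'] conditional_entropy_eq_diff[OF U simple_function_Pair[OF F Y]]
      conditional_entropy_eq_diff[OF G simple_function_Pair[OF F Y]] by simp
qed

lemma sum_conditional_entropy_le_entropy:
  assumes G: "simple_function M G"
    and U: "\<And>i. i \<in> {1..n} \<Longrightarrow> simple_function M (U i)"
    and F: "\<And>i. i \<in> {1..n} \<Longrightarrow> simple_function M (F i)"
    and Y: "\<And>i. i \<in> {1..Suc n} \<Longrightarrow> simple_function M (Y i)"
    and decode: "\<And>i. i \<in> {1..n} \<Longrightarrow> \<H>(U i | (\<lambda>x. (G x, F i x))) = 0"
    and equiv: "\<And>i x y. i \<in> {1..n} \<Longrightarrow> x \<in> space M \<Longrightarrow> y \<in> space M \<Longrightarrow>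
      Y (Suc i) x = Y (Suc i) y \<longleftrightarrow> U i x = U i y \<and> F i x = F i y \<and> Y i x = Y i y"
  shows "(\<Sum>i\<in>{1..n}. \<H>(U i | (\<lambda>x. (F i x, Y i x)))) \<le> \<H>(G)"
proof -
  \<comment> \<open>The invariant keeps the uncertainty about \<open>G\<close> left after
    \<open>m\<close> steps; each step trades part of it for one summand. At \<open>m = n\<close> the
    remainder is nonnegative and is dropped.\<close>
  have "(\<Sum>i\<in>{1..m}. \<H>(U i | (\<lambda>x. (F i x, Y i x)))) + \<H>(G | Y (Suc m)) \<le> \<H>(G)" if "m \<le> n" for m
    using that
  proof (induction m)
    case 0
    then show ?case
      using conditional_entropy_less_eq_entropy[OF G Y[of 1]] by simp
  next
    case (Suc m)
    then have i: "Suc m \<in> {1..n}"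
      by simp
    have "\<H>(U (Suc m) | (\<lambda>x. (F (Suc m) x, Y (Suc m) x))) + \<H>(G | Y (Suc (Suc m))) \<le> \<H>(G | Y (Suc m))"
      using i by (intro conditional_entropy_step[OF G U[OF i] F[OF i] Y Y decode[OF i] equiv[OF i]]) auto
    then show ?case
      using Suc by simp
  qed
  from this[of n] show ?thesis
    using conditional_entropy_nonneg[OF G Y[of "Suc n"]] by simp
qed

lemma entropy_le_log_card:
  assumes X: "simple_function M X" and A: "X ` space M \<subseteq> A" "finite A"
  shows "\<H>(X) \<le> log b (real (card A))"
proof -
  have "\<H>(X) \<le> log b (real (card (X ` space M)))"
    by (rule entropy_le_card[OF simple_distributedI[OF X measure_nonneg refl]])
  also have "\<dots> \<le> log b (real (card A))"
    using A b_gt_1 not_empty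
    by (intro log_mono) (auto simp: card_mono card_gt_0_iff dest: finite_subset)
  finally show ?thesis .
qed

end

text \<open>The tuple grows by one coordinate at a time, and function update is a binary operation
  applied to two simple functions.\<close>

lemma simple_function_restrict:
  assumes "finite I" and "\<And>i. i \<in> I \<Longrightarrow> simple_function M (X i)"
  shows "simple_function M (\<lambda>\<omega>. \<lambda>i\<in>I. X i \<omega>)"
  using assms
proof (induction I)
  case empty
  then show ?case by simp
next
  case (insert i I)
  have "simple_function M (\<lambda>\<omega>. (\<lambda>i\<in>I. X i \<omega>)(i := X i \<omega>))"
    by (rule simple_function_compose2[where h="\<lambda>f a. f(i := a)"]) (use insert in blast)+
  also have "(\<lambda>\<omega>. (\<lambda>i\<in>I. X i \<omega>)(i := X i \<omega>)) = (\<lambda>\<omega>. \<lambda>i\<in>insert i I. X i \<omega>)"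
    by (auto simp: fun_eq_iff)
  finally show ?case .
qed

subsection \<open>Intermediate values and messages\<close>

lemma card_bit_strings: "card (bit_strings n) = 2 ^ n" and finite_bit_strings: "finite (bit_strings n)"
  using card_lists_length_eq[of "UNIV :: bool set" n] finite_lists_length_eq[of "UNIV :: bool set" n]
  by (simp_all add: bit_strings_def)

lemma iv_tuple_eq_iff:
  "iv_tuple v I J \<omega> = iv_tuple v I J \<omega>' \<longleftrightarrow> (\<forall>i\<in>I. \<forall>j\<in>J. v i j \<omega> = v i j \<omega>')"
  by (auto simp: iv_tuple_def fun_eq_iff restrict_def)

lemma simple_function_iv_tuple:
  assumes "finite I" "finite J" "\<And>i j. i \<in> I \<Longrightarrow> j \<in> J \<Longrightarrow> simple_function P (v i j)"
  shows "simple_function P (iv_tuple v I J)"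
proof -
  have "iv_tuple v I J = (\<lambda>\<omega>. \<lambda>p\<in>I \<times> J. v (fst p) (snd p) \<omega>)"
    by (simp add: iv_tuple_def fun_eq_iff case_prod_beta)
  moreover have "simple_function P (\<lambda>\<omega>. \<lambda>p\<in>I \<times> J. v (fst p) (snd p) \<omega>)"
    using assms by (intro simple_function_restrict) auto
  ultimately show ?thesis
    by simp
qed

text \<open>There are \<open>2 ^ (T * card I)\<close> tuples, exactly as many as bit strings of
  length \<open>T * card I\<close>. The encoder serves to build a scheme in which nodes broadcast
  everything they compute.\<close>

lemma ex_injective_encoder:
  assumes "finite I"
  shows "\<exists>n f. f \<in> (I \<rightarrow>\<^sub>E bit_strings T) \<rightarrow> bit_strings n \<and> inj_on f (I \<rightarrow>\<^sub>E bit_strings T)"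
proof -
  have "card (I \<rightarrow>\<^sub>E bit_strings T) = 2 ^ (T * card I)"
    using assms by (simp add: card_PiE card_bit_strings power_mult)
  then have "card (I \<rightarrow>\<^sub>E bit_strings T) \<le> card (bit_strings (T * card I))"
    by (simp add: card_bit_strings)
  moreover have "finite (I \<rightarrow>\<^sub>E bit_strings T)"
    using assms by (simp add: finite_PiE finite_bit_strings)
  ultimately obtain f where "f ` (I \<rightarrow>\<^sub>E bit_strings T) \<subseteq> bit_strings (T * card I)"
      "inj_on f (I \<rightarrow>\<^sub>E bit_strings T)"
    using card_le_inj finite_bit_strings by blast
  then show ?thesis
    by blast
qed

theorem theorem4:
  fixes P :: "'a measure"
    and K N Q T :: nat
    and F :: "nat \<Rightarrow> 'f measure"
    and w :: "nat \<Rightarrow> 'a \<Rightarrow> 'f"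
    and \<phi> :: "nat \<Rightarrow> nat \<Rightarrow> 'f \<Rightarrow> bool list"
    and v :: "nat \<Rightarrow> nat \<Rightarrow> 'a \<Rightarrow> bool list"
    and M W :: "nat \<Rightarrow> nat set"
    and \<kappa> :: "nat \<Rightarrow> nat"
  assumes "prob_space P"
    and "0 < K" "0 < N" "0 < Q" "0 < T"
    and files: "\<And>j. j \<in> {1..N} \<Longrightarrow> w j \<in> P \<rightarrow>\<^sub>M F j"
    and maps: "\<And>i j. i \<in> {1..Q} \<Longrightarrow> j \<in> {1..N} \<Longrightarrow> \<phi> i j \<in> F j \<rightarrow>\<^sub>M count_space (bit_strings T)"
    and ivs: "\<And>i j \<omega>. i \<in> {1..Q} \<Longrightarrow> j \<in> {1..N} \<Longrightarrow> \<omega> \<in> space P \<Longrightarrow> v i j \<omega> = \<phi> i j (w j \<omega>)"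
    and placement: "\<And>k. k \<in> {1..K} \<Longrightarrow> M k \<subseteq> {1..N}"
    and available: "(\<Union>k\<in>{1..K}. M k) = {1..N}"
    and assignment: "(\<Union>k\<in>{1..K}. W k) = {1..Q}"
    and disjoint: "disjoint_family_on W {1..K}"
    and perm: "bij_betw \<kappa> {1..K} {1..K}"
  shows "optimal_load P K N Q T v M W \<ge>
    (1 / (real T * real Q * real N)) *
      (\<Sum>i\<in>{1..K}. cond_entropy P (V_funs N v (W (\<kappa> i)))
         (\<lambda>\<omega>. (V_files Q v (M (\<kappa> i)) \<omega>, Y_nodes N Q v M W (\<kappa> ` {1..<i}) \<omega>)))"
proof -
  interpret P: prob_space P by fact
  interpret information_space P 2 by unfold_locales simp

  \<comment> \<open>Measurability and ranges of the intermediate values, tuples and messages\<close>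
  have v_meas: "v i j \<in> P \<rightarrow>\<^sub>M count_space (bit_strings T)" if "i \<in> {1..Q}" "j \<in> {1..N}" for i j
  proof -
    have "(\<lambda>\<omega>. \<phi> i j (w j \<omega>)) \<in> P \<rightarrow>\<^sub>M count_space (bit_strings T)"
      using measurable_compose[OF files maps] that by blast
    then show ?thesis
      using ivs that by (subst measurable_cong) auto
  qed
  have v_range: "v i j \<omega> \<in> bit_strings T" if "i \<in> {1..Q}" "j \<in> {1..N}" "\<omega> \<in> space P" for i j \<omega>
    using measurable_space[OF v_meas] that by simp
  \<comment> \<open>Measurability into a finite set of bit strings is what makes the entropy lemmas
    for simple functions applicable.\<close>
  have v_sf: "simple_function P (v i j)" if ij: "i \<in> {1..Q}" "j \<in> {1..N}" for i j
    unfolding simple_function_def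
  proof
    show "finite (v i j ` space P)"
      by (rule finite_subset[OF _ finite_bit_strings[of T]]) (use v_range ij in auto)
    show "\<forall>x\<in>v i j ` space P. v i j -` {x} \<inter> space P \<in> sets P"
      using v_range ij by (auto intro!: measurable_sets[OF v_meas[OF ij]])
  qed
  have tuple_sf: "simple_function P (iv_tuple v I J)" if "I \<subseteq> {1..Q}" "J \<subseteq> {1..N}" for I J
  proof (rule simple_function_iv_tuple)
    show "finite I" "finite J"
      using that by (simp_all add: finite_subset)
    show "simple_function P (v i j)" if "i \<in> I" "j \<in> J" for i j
      using v_sf \<open>I \<subseteq> {1..Q}\<close> \<open>J \<subseteq> {1..N}\<close> that by blast
  qed
  have W: "W k \<subseteq> {1..Q}" if "k \<in> {1..K}" for k
    using assignment that by auto
  have files_sf: "simple_function P (V_files Q v (M k))" and funs_sf: "simple_function P (V_funs N v (W k))"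
    if "k \<in> {1..K}" for k
    unfolding V_files_def V_funs_def
    by (rule tuple_sf; use that placement W in simp)+
  have files_range: "V_files Q v (M k) \<omega> \<in> ({1..Q} \<times> M k) \<rightarrow>\<^sub>E bit_strings T"
    if "k \<in> {1..K}" "\<omega> \<in> space P" for k \<omega>
    using that v_range placement[of k] by (auto simp: V_files_def iv_tuple_def PiE_iff subset_iff)
  have nodes_sf: "simple_function P (Y_nodes N Q v M W S)" if "S \<subseteq> {1..K}" for S
  proof -
    have "(\<Union>k\<in>S. W k) \<subseteq> {1..Q}" "(\<Union>k\<in>S. M k) \<subseteq> {1..N}"
      using placement W \<open>S \<subseteq> {1..K}\<close> by (meson UN_least subsetD)+
    then show ?thesis
      unfolding Y_nodes_def[abs_def] V_funs_def V_files_def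
      by (intro simple_function_Pair tuple_sf order_refl)
  qed
  have messages_sf: "simple_function P (messages K Q v M enc)" for enc
    unfolding messages_def[abs_def]
    using simple_function_compose1[OF files_sf] by (rule simple_function_restrict[OF finite_atLeastAtMost])
  \<comment> \<open>Agreement on the unions splits into agreement node by node, even when file sets
    overlap. Hence adding a node to \<open>S\<close> reveals exactly its two tuples.\<close>
  have Y_eq_iff: "Y_nodes N Q v M W S \<omega> = Y_nodes N Q v M W S \<omega>' \<longleftrightarrow>
      (\<forall>k\<in>S. V_funs N v (W k) \<omega> = V_funs N v (W k) \<omega>' \<and> V_files Q v (M k) \<omega> = V_files Q v (M k) \<omega>')"
    for S \<omega> \<omega>'
    by (auto simp: Y_nodes_def V_funs_def V_files_def iv_tuple_eq_iff)

  \<comment> \<open>The bound for one achievable scheme\<close>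
  let ?S = "\<Sum>i\<in>{1..K}. cond_entropy P (V_funs N v (W (\<kappa> i)))
    (\<lambda>\<omega>. (V_files Q v (M (\<kappa> i)) \<omega>, Y_nodes N Q v M W (\<kappa> ` {1..<i}) \<omega>))"
  have lower: "?S \<le> (\<Sum>k\<in>{1..K}. real (len k))"
    if scheme: "shuffle_scheme K Q T M len enc" and ach: "achievable P K N Q v M W enc" for len enc
  proof -
    define G where "G = messages K Q v M enc"
    \<comment> \<open>The half-open interval makes \<open>Y n\<close> describe the nodes strictly
      before position \<open>n\<close>: \<open>Y 1\<close> is trivial and \<open>Y (Suc K)\<close>
      covers all nodes.\<close>
    define Y where "Y n = Y_nodes N Q v M W (\<kappa> ` {1..<n})" for n
    have \<kappa>: "\<kappa> i \<in> {1..K}" if "i \<in> {1..K}" for i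
      using perm that by (auto simp: bij_betw_def)
    have G: "simple_function P G"
      unfolding G_def by (rule messages_sf)
    have Y: "simple_function P (Y n)" if "n \<in> {1..Suc K}" for n
      unfolding Y_def
    proof (rule nodes_sf)
      show "\<kappa> ` {1..<n} \<subseteq> {1..K}"
        using \<kappa> that by fastforce
    qed
    have decode: "cond_entropy P (V_funs N v (W (\<kappa> i))) (\<lambda>\<omega>. (G \<omega>, V_files Q v (M (\<kappa> i)) \<omega>)) = 0"
      if "i \<in> {1..K}" for i
      using ach \<kappa>[OF that] unfolding achievable_def G_def by blast
    have equiv: "Y (Suc i) \<omega> = Y (Suc i) \<omega>' \<longleftrightarrow>
        V_funs N v (W (\<kappa> i)) \<omega> = V_funs N v (W (\<kappa> i)) \<omega>' \<and>
        V_files Q v (M (\<kappa> i)) \<omega> = V_files Q v (M (\<kappa> i)) \<omega>' \<and> Y i \<omega> = Y i \<omega>'"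
      if "i \<in> {1..K}" for i \<omega> \<omega>'
    proof -
      have "\<kappa> ` {1..<Suc i} = insert (\<kappa> i) (\<kappa> ` {1..<i})"
        using that by (simp add: atLeastLessThanSuc)
      then show ?thesis
        by (simp add: Y_def Y_eq_iff)
    qed
    have "?S \<le> P.entropy 2 (count_space (G ` space P)) G"
      using sum_conditional_entropy_le_entropy[where n=K and Y=Y and
          U="\<lambda>i. V_funs N v (W (\<kappa> i))" and F="\<lambda>i. V_files Q v (M (\<kappa> i))",
          folded cond_entropy_def, OF G funs_sf[OF \<kappa>] files_sf[OF \<kappa>] Y decode equiv]
      by (simp add: Y_def)
    \<comment> \<open>The message tuple takes values in a product of size 2 to the sum of the
      lengths, whose base-2 logarithm is the total number of bits sent.\<close>
    also have "\<dots> \<le> log 2 (real (card (PiE {1..K} (\<lambda>k. bit_strings (len k)))))"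
    proof (rule entropy_le_log_card[OF G])
      show "G ` space P \<subseteq> PiE {1..K} (\<lambda>k. bit_strings (len k))"
        using scheme files_range unfolding G_def messages_def shuffle_scheme_def
        by (fastforce simp: PiE_iff Pi_iff)
    qed (simp add: finite_PiE finite_bit_strings)
    also have "real (card (PiE {1..K} (\<lambda>k. bit_strings (len k)))) = 2 ^ (\<Sum>k\<in>{1..K}. len k)"
      by (simp add: card_PiE card_bit_strings power_sum)
    finally show ?thesis
      by simp
  qed

  \<comment> \<open>Existence of an achievable scheme\<close>
  have "\<exists>len enc. shuffle_scheme K Q T M len enc \<and> achievable P K N Q v M W enc"
  proof -
    \<comment> \<open>The greatest-lower-bound rule for a real infimum asks for a nonempty set. The
      witness is uncoded broadcast: each node sends an injective encoding of all its intermediate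
      values.\<close>
    have "\<exists>n f. f \<in> (({1..Q} \<times> M k) \<rightarrow>\<^sub>E bit_strings T) \<rightarrow> bit_strings n
        \<and> inj_on f (({1..Q} \<times> M k) \<rightarrow>\<^sub>E bit_strings T)" if "k \<in> {1..K}" for k
      using placement[OF that] by (intro ex_injective_encoder) (auto intro: finite_subset)
    then obtain len enc where
      enc: "\<And>k. k \<in> {1..K} \<Longrightarrow> enc k \<in> (({1..Q} \<times> M k) \<rightarrow>\<^sub>E bit_strings T) \<rightarrow> bit_strings (len k)" and
      inj: "\<And>k. k \<in> {1..K} \<Longrightarrow> inj_on (enc k) (({1..Q} \<times> M k) \<rightarrow>\<^sub>E bit_strings T)"
      by metis
    \<comment> \<open>By \<open>available\<close>, file \<open>j\<close> lies at some node
      \<open>k\<close>, and the injective message of \<open>k\<close> reveals \<open>v i j\<close>.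
      So the messages alone determine every intermediate value.\<close>
    have det: "v i j \<omega> = v i j \<omega>'"
      if \<omega>: "\<omega> \<in> space P" "\<omega>' \<in> space P" and eq: "messages K Q v M enc \<omega> = messages K Q v M enc \<omega>'"
        and ij: "i \<in> {1..Q}" "j \<in> {1..N}" for i j \<omega> \<omega>'
    proof -
      have "j \<in> (\<Union>k\<in>{1..K}. M k)"
        unfolding available by (fact ij)
      then obtain k where k: "k \<in> {1..K}" "j \<in> M k"
        by blast
      have "enc k (V_files Q v (M k) \<omega>) = enc k (V_files Q v (M k) \<omega>')"
        using fun_cong[OF eq, of k] k by (simp add: messages_def)
      then have "V_files Q v (M k) \<omega> = V_files Q v (M k) \<omega>'"
        using inj_onD[OF inj[OF k(1)]] files_range[OF k(1)] \<omega> by simp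
      then show ?thesis
        using k ij by (simp add: V_files_def iv_tuple_eq_iff)
    qed
    have "achievable P K N Q v M W enc"
      unfolding achievable_def
    proof
      fix k assume k: "k \<in> {1..K}"
      show "cond_entropy P (V_funs N v (W k)) (\<lambda>\<omega>. (messages K Q v M enc \<omega>, V_files Q v (M k) \<omega>)) = 0"
        unfolding cond_entropy_def
      proof (rule conditional_entropy_eq_0_determined[OF funs_sf[OF k] simple_function_Pair[OF messages_sf files_sf[OF k]]])
        fix \<omega> \<omega>' assume "\<omega> \<in> space P" "\<omega>' \<in> space P"
          "(messages K Q v M enc \<omega>, V_files Q v (M k) \<omega>) = (messages K Q v M enc \<omega>', V_files Q v (M k) \<omega>')"
        then show "V_funs N v (W k) \<omega> = V_funs N v (W k) \<omega>'"
          using det W[OF k] unfolding V_funs_def iv_tuple_eq_iff by blast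
      qed
    qed
    moreover have "shuffle_scheme K Q T M len enc"
      using enc by (simp add: shuffle_scheme_def)
    ultimately show ?thesis
      by blast
  qed

  \<comment> \<open>Passage to the infimum\<close>
  then show ?thesis
    unfolding optimal_load_def
  proof (intro cInf_greatest)
    fix x assume "x \<in> {comm_load K N Q T len |len enc.
        shuffle_scheme K Q T M len enc \<and> achievable P K N Q v M W enc}"
    then obtain len enc where x: "x = comm_load K N Q T len"
      and "shuffle_scheme K Q T M len enc" "achievable P K N Q v M W enc"
      by blast
    then have "?S \<le> (\<Sum>k\<in>{1..K}. real (len k))"
      using lower by blast
    then have "1 / (real T * real Q * real N) * ?S \<le>
        1 / (real T * real Q * real N) * (\<Sum>k\<in>{1..K}. real (len k))"
      by (rule mult_left_mono) simp
    then show "1 / (real T * real Q * real N) * ?S \<le> x"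
      by (simp add: x comm_load_def mult.commute mult.left_commute)
  qed blast
qed

end
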